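(* Let $u\in C(\bar U\times[0,T])\cap C^{2,1}_{x,t}(U\times(0,T])$ with $u\ge0$ solve the problem $$\begin{cases}\phi u_t=\nabla\cdot\big(X(\nabla u+u^2\mathcal Z(x,t))\big)&\text{in }U\times(0,T],\\ u(x,0)=u_0(x)&\text{in }U,\\ u(x,t)=\psi(x,t)&\text{on }\partial U\times(0,T]\end{cases}$$ on a time interval $[0,T]$ for some $T>0$. Then for all $t\in[0,T]$, $$\max_{x\in\bar U}u(x,t)\le M_0(t):=\sup_{x\in U}|u_0(x)|+\sup_{(x,\tau)\in\partial U\times(0,t]}|\psi(x,\tau)|.$$
   Context: $N\ge1$ is an integer, $0=\alpha_0<\alpha_1<\dots<\alpha_N$ are real numbers, $a_0,\dots,a_N>0$ are constants, and $g(s)=\sum_{i=0}^N a_is^{\alpha_i}$ for $s\ge0$. $\vec k\in\mathbb R^3$ is a fixed unit vector, $\mathbf J$ is the $3\times3$ matrix with $\mathbf Jx=\vec k\times x$ for all $x\in\mathbb R^3$, and $\mathcal R\ge0$ is a constant. The function $F:\mathbb R^3\to\mathbb R^3$, $F(v)=g(|v|)v+\mathcal R\,\mathbf Jv$, is a $C^1$ bijection whose inverse $X=F^{-1}$ is also $C^1$. $U\subset\mathbb R^3$ is an open bounded set with $C^1$ boundary; $\phi>0$, $\mathcal G>0$, $\Omega\ge0$ are constants, $e_0:\mathbb R\to\mathbb R^3$ is a smooth function with $|e_0(t)|=1$, and $\mathcal Z(x,t)=-\mathcal G e_0(t)+\Omega^2\mathbf J^2x$. The gradient and divergence are in $x$.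 $C^{2,1}_{x,t}$ means twice continuously differentiable in $x$ and once in $t$. For $t=0$ the supremum over the empty set $\partial U\times(0,0]$ is taken to be $0$. *)

theory Defs
  imports "HOL-Analysis.Analysis"
begin

text \<open>Unlike \<^term>\<open>(powr)\<close>, this takes \<open>0\<close> to the power \<open>0\<close> to be \<open>1\<close>,
  so that the term with exponent \<open>\<alpha> 0 = 0\<close> below is the constant \<open>a 0\<close> also at \<open>s = 0\<close>.\<close>

definition rpow :: "real \<Rightarrow> real \<Rightarrow> real" where
  "rpow s p = (if p = 0 then 1 else s powr p)"

definition gpoly :: "nat \<Rightarrow> (nat \<Rightarrow> real) \<Rightarrow> (nat \<Rightarrow> real) \<Rightarrow> real \<Rightarrow> real" where
  "gpoly N a \<alpha> s = (\<Sum>i\<le>N. a i * rpow s (\<alpha> i))"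

definition Jmat :: "real^3 \<Rightarrow> real^3^3" where
  "Jmat k = matrix (cross3 k)"

definition Fmap ::
  "nat \<Rightarrow> (nat \<Rightarrow> real) \<Rightarrow> (nat \<Rightarrow> real) \<Rightarrow> real \<Rightarrow> real^3 \<Rightarrow> real^3 \<Rightarrow> real^3" where
  "Fmap N a \<alpha> \<R> k v = gpoly N a \<alpha> (norm v) *\<^sub>R v + \<R> *\<^sub>R (Jmat k *v v)"

definition Zfield ::
  "real \<Rightarrow> real \<Rightarrow> real^3 \<Rightarrow> (real \<Rightarrow> real^3) \<Rightarrow> real^3 \<Rightarrow> real \<Rightarrow> real^3" where
  "Zfield \<G> \<Omega> k e0 x t = - (\<G> *\<^sub>R e0 t) + \<Omega>\<^sup>2 *\<^sub>R ((Jmat k ** Jmat k) *v x)"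

definition C1_on :: "'a::real_normed_vector set \<Rightarrow> ('a \<Rightarrow> 'b::real_normed_vector) \<Rightarrow> bool" where
  "C1_on S f \<longleftrightarrow> (\<exists>f' :: 'a \<Rightarrow> 'a \<Rightarrow>\<^sub>L 'b.
     (\<forall>x\<in>S. (f has_derivative blinfun_apply (f' x)) (at x)) \<and> continuous_on S f')"

definition smooth_curve :: "(real \<Rightarrow> 'a::real_normed_vector) \<Rightarrow> bool" where
  "smooth_curve f \<longleftrightarrow> (\<exists>d :: nat \<Rightarrow> real \<Rightarrow> 'a. d 0 = f \<and>
     (\<forall>n t. (d n has_vector_derivative d (Suc n) t) (at t)))"

text \<open>Near each boundary point, after an orthogonal change of coordinates \<open>Q\<close>,
  the set is the part of a ball lying above the graph of a \<open>C\<^sup>1\<close> function of the first two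
  coordinates.\<close>

definition C1_boundary :: "(real^3) set \<Rightarrow> bool" where
  "C1_boundary U \<longleftrightarrow> (\<forall>x0\<in>frontier U. \<exists>r>0. \<exists>Q :: real^3 \<Rightarrow> real^3. \<exists>\<gamma> :: real^2 \<Rightarrow> real.
     orthogonal_transformation Q \<and> C1_on UNIV \<gamma> \<and>
     U \<inter> ball x0 r = {x \<in> ball x0 r. \<gamma> (vector [Q x $ 1, Q x $ 2]) < Q x $ 3})"

definition grad :: "(real^'n \<Rightarrow> real) \<Rightarrow> real^'n \<Rightarrow> real^'n" where
  "grad f x = (\<chi> i. frechet_derivative f (at x) (axis i 1))"

definition divergence :: "(real^'n \<Rightarrow> real^'n) \<Rightarrow> real^'n \<Rightarrow> real" where
  "divergence V x = trace (jacobian V (at x))"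

definition hessian :: "(real^'n \<Rightarrow> real) \<Rightarrow> real^'n \<Rightarrow> real^'n^'n" where
  "hessian f x = jacobian (grad f) (at x)"

text \<open>Derivatives in time are taken within \<open>I\<close>, hence one-sided at the end point \<open>T\<close>
  when \<open>I\<close> is \<open>{0<..T}\<close>.\<close>

definition time_deriv ::
  "real set \<Rightarrow> (real^'n \<Rightarrow> real \<Rightarrow> real) \<Rightarrow> real^'n \<Rightarrow> real \<Rightarrow> real" where
  "time_deriv I u x t = vector_derivative (u x) (at t within I)"

definition C21_on :: "(real^'n) set \<Rightarrow> real set \<Rightarrow> (real^'n \<Rightarrow> real \<Rightarrow> real) \<Rightarrow> bool" where
  "C21_on U I u \<longleftrightarrow>
     (\<forall>x\<in>U. \<forall>t\<in>I. (\<lambda>y. u y t) differentiable (at x)) \<and>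
     (\<forall>x\<in>U. \<forall>t\<in>I. grad (\<lambda>y. u y t) differentiable (at x)) \<and>
     (\<forall>x\<in>U. \<forall>t\<in>I. u x differentiable (at t within I)) \<and>
     continuous_on (U \<times> I) (\<lambda>(x, t). u x t) \<and>
     continuous_on (U \<times> I) (\<lambda>(x, t). grad (\<lambda>y. u y t) x) \<and>
     continuous_on (U \<times> I) (\<lambda>(x, t). hessian (\<lambda>y. u y t) x) \<and>
     continuous_on (U \<times> I) (\<lambda>(x, t). time_deriv I u x t)"

definition sup_abs :: "('a \<Rightarrow> real) \<Rightarrow> 'a set \<Rightarrow> real" where
  "sup_abs f A = (if A = {} then 0 else (SUP x\<in>A. \<bar>f x\<bar>))"

definition M0 ::
  "(real^3) set \<Rightarrow> (real^3 \<Rightarrow> real) \<Rightarrow> (real^3 \<Rightarrow> real \<Rightarrow> real) \<Rightarrow> real \<Rightarrow> real" where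
  "M0 U u0 \<psi> t = sup_abs u0 U + sup_abs (\<lambda>(x, \<tau>). \<psi> x \<tau>) (frontier U \<times> {0<..t})"

end

theory Submission
  imports Defs
begin

text \<open>At an interior spatial maximum the gradient vanishes, so the divergence is the trace of
  \<open>DX (D\<^sup>2u + u\<^sup>2\<Omega>\<^sup>2 J\<^sup>2)\<close>. Since \<open>F\<close> is monotone, so is its inverse \<open>X\<close>, hence \<open>DX\<close> has a nonnegative
  quadratic form; the other factor is symmetric and negative semidefinite, because \<open>J\<close> is
  antisymmetric. So the trace is nonpositive: the zeroth order term has the good sign, and the
  classical maximum principle argument applied to \<open>u - \<epsilon>t\<close> goes through.\<close>

section \<open>Sign of the trace of a product of two operators\<close>

lemma trace_matrix_eq_sum_Basis:
  fixes L :: "real^'n \<Rightarrow> real^'n"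
  shows "trace (matrix L) = (\<Sum>b\<in>Basis. L b \<bullet> b)"
proof -
  have B: "Basis = range (\<lambda>i::'n. axis i (1::real))"
    by (auto simp: Basis_vec_def)
  have inj: "inj (\<lambda>i::'n. axis i (1::real))"
    by (auto simp: inj_def axis_eq_axis)
  show ?thesis
    unfolding B by (simp add: sum.reindex[OF inj] trace_def matrix_def inner_axis)
qed

text \<open>Along the line \<open>B e + s *\<^sub>R e\<close> the quadratic form is affine in
  \<open>s\<close> with slope twice the squared norm of \<open>B e\<close>, because its quadratic
  coefficient is \<open>B e \<bullet> e = 0\<close>. An affine function bounded below on the whole
  line has slope zero.\<close>

lemma psd_operator_zero_direction:
  fixes B :: "'a::real_inner \<Rightarrow> 'a"
  assumes "linear B" and sym: "\<And>x y. B x \<bullet> y = B y \<bullet> x"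
    and psd: "\<And>x. 0 \<le> B x \<bullet> x" and e: "B e \<bullet> e = 0"
  shows "B e = 0"
proof (rule ccontr)
  interpret linear B by fact
  assume "B e \<noteq> 0"
  define n q where "n = B e \<bullet> B e" and "q = B (B e) \<bullet> B e"
  have n: "n > 0" using \<open>B e \<noteq> 0\<close> by (simp add: n_def)
  have "0 \<le> q + 2 * s * n" for s
  proof -
    have "B (B e + s *\<^sub>R e) \<bullet> (B e + s *\<^sub>R e) = q + 2 * s * n"
      using sym[of "B e" e] e by (simp add: add scale inner_add_left inner_add_right n_def q_def)
    then show ?thesis using psd[of "B e + s *\<^sub>R e"] by simp
  qed
  \<comment> \<open>This choice of \<open>s\<close> makes the affine expression equal to -1.\<close>
  from this[of "- (q + 1) / (2 * n)"] n show False by (simp add: field_simps)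
qed

text \<open>Subtracting \<open>(B e \<bullet> \<cdot>) B e / (B e \<bullet> e)\<close>, one step of the Cholesky elimination, splits
  off a rank-one summand whose contribution to the sum is \<open>A (B e) \<bullet> B e / (B e \<bullet> e)\<close>.\<close>

lemma sum_Basis_compose_nonneg:
  fixes A B :: "'a::euclidean_space \<Rightarrow> 'a"
  assumes A: "linear A" "\<And>x. 0 \<le> A x \<bullet> x"
    and "linear B" "\<And>x y. B x \<bullet> y = B y \<bullet> x" "\<And>x. 0 \<le> B x \<bullet> x"
  shows "0 \<le> (\<Sum>b\<in>Basis. A (B b) \<bullet> b)"
proof -
  interpret A: linear A by fact
  \<comment> \<open>Generalised for induction: \<open>S\<close> contains every basis vector that
    \<open>B\<close> does not annihilate. \<open>B\<close> stays arbitrary because each elimination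
    step replaces it.\<close>
  have "0 \<le> (\<Sum>b\<in>Basis. A (B b) \<bullet> b)"
    if "finite S" "S \<subseteq> Basis" "linear B" "\<And>x y. B x \<bullet> y = B y \<bullet> x" "\<And>x. 0 \<le> B x \<bullet> x"
      "\<And>b. b \<in> Basis - S \<Longrightarrow> B b = 0" for S and B :: "'a \<Rightarrow> 'a"
    using that
  proof (induction S arbitrary: B rule: finite_induct)
    case empty
    then show ?case by (simp add: A.zero)
  next
    case (insert e S)
    interpret B: linear B by fact
    note sym = insert.prems(3) and psd = insert.prems(4) and zero = insert.prems(5)
    show ?case
    proof (cases "B e \<bullet> e = 0")
      case True
      then have "B e = 0"
        using psd_operator_zero_direction[OF \<open>linear B\<close> sym psd] by blast
      then show ?thesis
        by (intro insert.IH) (use insert.prems in auto)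
    next
      case False
      define c where "c = B e \<bullet> e"
      have c: "c > 0" using False psd[of e] by (simp add: c_def)
      define B' where "B' x = B x - ((B e \<bullet> x) / c) *\<^sub>R B e" for x
      have "0 \<le> (\<Sum>b\<in>Basis. A (B' b) \<bullet> b)"
      proof (rule insert.IH)
        show "S \<subseteq> Basis" using insert.prems by auto
        show "linear B'"
          by (rule linearI)
            (auto simp: B'_def B.add B.scale inner_add_right add_divide_distrib algebra_simps)
        show "B' x \<bullet> y = B' y \<bullet> x" for x y
          using sym[of x y] by (simp add: B'_def inner_diff_left)
        show "B' b = 0" if "b \<in> Basis - S" for b
        proof (cases "b = e")
          case True
          then show ?thesis using c by (simp add: B'_def c_def)
        next
          case False
          then have "B b = 0" using that zero by auto
          then show ?thesis using sym[of e b] by (simp add: B'_def)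
        qed
        show "0 \<le> B' x \<bullet> x" for x
        proof -
          \<comment> \<open>Completing the square: this \<open>s\<close> minimises the form of
            \<open>B\<close> along \<open>x - s *\<^sub>R e\<close>, and the minimum is
            \<open>B' x \<bullet> x\<close>. Hence \<open>B'\<close> inherits nonnegativity from
            \<open>B\<close>.\<close>
          define s where "s = (B e \<bullet> x) / c"
          have "B (x - s *\<^sub>R e) \<bullet> (x - s *\<^sub>R e)
              = B x \<bullet> x - 2 * s * (B e \<bullet> x) + s\<^sup>2 * c"
            using sym[of x e]
            by (simp add: B.diff B.scale inner_diff_left inner_diff_right c_def
                power2_eq_square algebra_simps)
          also have "\<dots> = B x \<bullet> x - s * (B e \<bullet> x)"
            using c by (simp add: s_def power2_eq_square field_simps)
          also have "\<dots> = B' x \<bullet> x"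
            by (simp add: B'_def s_def inner_diff_left)
          finally show ?thesis using psd[of "x - s *\<^sub>R e"] by simp
        qed
      qed
      moreover have "(\<Sum>b\<in>Basis. A (B b) \<bullet> b)
          = (\<Sum>b\<in>Basis. A (B' b) \<bullet> b) + (A (B e) \<bullet> B e) / c"
      proof -
        have "A (B b) \<bullet> b = A (B' b) \<bullet> b + (A (B e) \<bullet> b) * (B e \<bullet> b) / c" for b
          by (simp add: B'_def A.diff A.scale inner_diff_left)
        then show ?thesis
          by (simp add: sum.distrib sum_divide_distrib[symmetric] euclidean_inner[of "A (B e)" "B e"])
      qed
      ultimately show ?thesis
        using c A(2)[of "B e"] by simp
    qed
  qed
  from this[of Basis B] show ?thesis
    using assms by auto
qed

text \<open>Apply the preceding sum estimate to \<open>- B\<close>. For \<open>A\<close> only the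
  quadratic form is controlled, since the rotation in \<open>F\<close> makes the derivative of
  \<open>X\<close> non-symmetric in general.\<close>

lemma trace_compose_nonpos:
  fixes A B :: "real^'n \<Rightarrow> real^'n"
  assumes A: "linear A" "\<And>x. 0 \<le> A x \<bullet> x"
    and B: "linear B" "\<And>x y. B x \<bullet> y = B y \<bullet> x" "\<And>x. B x \<bullet> x \<le> 0"
  shows "trace (matrix (\<lambda>x. A (B x))) \<le> 0"
proof -
  have "0 \<le> (\<Sum>b\<in>Basis. A (- B b) \<bullet> b)"
    by (rule sum_Basis_compose_nonneg) (use A B in \<open>auto simp: linear_compose_neg\<close>)
  then show ?thesis
    using A(1) by (simp add: trace_matrix_eq_sum_Basis linear_neg sum_negf)
qed

section \<open>Second derivatives: symmetry, and sign at a maximum\<close>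

text \<open>The mean value theorem along \<open>v\<close> reduces the second difference to a first
  difference of \<open>G\<close>, and linearising \<open>G\<close> at \<open>x\<close> turns that
  into \<open>H w\<close>. The derivative of \<open>G\<close> is thus used at \<open>x\<close> only.
  The purpose is symmetry: the second difference does not change when \<open>v\<close> and
  \<open>w\<close> are swapped.\<close>

lemma second_difference_bound:
  fixes f :: "'a::real_inner \<Rightarrow> real"
  assumes f: "\<And>y. norm (y - x) < d \<Longrightarrow> (f has_derivative (\<lambda>h. G y \<bullet> h)) (at y)"
    and G: "\<And>y. norm (y - x) < d \<Longrightarrow> norm (G y - G x - H (y - x)) \<le> e * norm (y - x)"
    and H: "linear H" and "0 \<le> e" and small: "norm v + norm w < d"
  shows "\<bar>f (x + v + w) - f (x + v) - f (x + w) + f x - H w \<bullet> v\<bar>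
    \<le> 2 * e * (norm v + norm w)\<^sup>2"
proof -
  \<comment> \<open>The increment of \<open>p\<close> from 0 to 1 is exactly the second
    difference.\<close>
  define p where "p s = f (x + s *\<^sub>R v + w) - f (x + s *\<^sub>R v)" for s
  define L where "L = norm v + norm w"
  have near: "norm (s *\<^sub>R v + w) \<le> L" "norm (s *\<^sub>R v) \<le> L" if "0 \<le> s" "s \<le> 1" for s
  proof -
    have "norm (s *\<^sub>R v) \<le> norm v"
      using that by (simp add: mult_left_le_one_le)
    then show "norm (s *\<^sub>R v + w) \<le> L" "norm (s *\<^sub>R v) \<le> L"
      using norm_triangle_ineq[of "s *\<^sub>R v" w] unfolding L_def by (smt (verit) norm_ge_zero)+
  qed
  have "(p has_derivative (\<lambda>h. h * ((G (x + s *\<^sub>R v + w) - G (x + s *\<^sub>R v)) \<bullet> v)))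
      (at s within {0..1})" if "0 \<le> s" "s \<le> 1" for s
  proof -
    have "((\<lambda>s. f (x + s *\<^sub>R v + w)) has_derivative (\<lambda>h. G (x + s *\<^sub>R v + w) \<bullet> (h *\<^sub>R v)))
        (at s within {0..1})"
      by (rule has_derivative_compose[where g = f and f = "\<lambda>s. x + s *\<^sub>R v + w"])
        (use near[OF that] small f[of "x + s *\<^sub>R v + w"] in
          \<open>auto intro!: derivative_eq_intros simp: L_def add.assoc\<close>)
    moreover have "((\<lambda>s. f (x + s *\<^sub>R v)) has_derivative (\<lambda>h. G (x + s *\<^sub>R v) \<bullet> (h *\<^sub>R v)))
        (at s within {0..1})"
      by (rule has_derivative_compose[where g = f and f = "\<lambda>s. x + s *\<^sub>R v"])
        (use near[OF that] small f[of "x + s *\<^sub>R v"] in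
          \<open>auto intro!: derivative_eq_intros simp: L_def\<close>)
    ultimately show ?thesis
      unfolding p_def
      by (rule has_derivative_eq_rhs[OF has_derivative_diff])
        (simp add: inner_diff_left algebra_simps)
  qed
  then obtain s where s: "0 < s" "s < 1"
    and ps: "p 1 - p 0 = (G (x + s *\<^sub>R v + w) - G (x + s *\<^sub>R v)) \<bullet> v"
    using mvt_simple[of 0 1 p "\<lambda>s h. h * ((G (x + s *\<^sub>R v + w) - G (x + s *\<^sub>R v)) \<bullet> v)"] by auto
  have nr: "norm (s *\<^sub>R v + w) \<le> L" "norm (s *\<^sub>R v) \<le> L"
    using near[of s] s by auto
  \<comment> \<open>\<open>r1\<close> and \<open>r2\<close> are the linearisation errors of
    \<open>G\<close> at the two points. The linear parts differ by \<open>H w\<close>, as the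
    contributions of \<open>s *\<^sub>R v\<close> cancel.\<close>
  define r1 where "r1 = G (x + s *\<^sub>R v + w) - G x - H (s *\<^sub>R v + w)"
  define r2 where "r2 = G (x + s *\<^sub>R v) - G x - H (s *\<^sub>R v)"
  have "norm r1 \<le> e * L"
    using G[of "x + s *\<^sub>R v + w"] nr small mult_left_mono[OF nr(1) \<open>0 \<le> e\<close>]
    by (simp add: r1_def L_def add.assoc)
  moreover have "norm r2 \<le> e * L"
    using G[of "x + s *\<^sub>R v"] nr small mult_left_mono[OF nr(2) \<open>0 \<le> e\<close>]
    by (simp add: r2_def L_def)
  ultimately have r: "norm (r1 - r2) \<le> 2 * e * L"
    using norm_triangle_ineq4[of r1 r2] by linarith
  have "f (x + v + w) - f (x + v) - f (x + w) + f x - H w \<bullet> v = (r1 - r2) \<bullet> v"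
    using ps by (simp add: p_def r1_def r2_def linear_add[OF H] inner_diff_left inner_add_left)
  also have "\<bar>\<dots>\<bar> \<le> norm (r1 - r2) * norm v"
    by (rule Cauchy_Schwarz_ineq2)
  also have "\<dots> \<le> (2 * e * L) * L"
    using r \<open>0 \<le> e\<close> by (intro mult_mono) (auto simp: L_def)
  finally show ?thesis by (simp add: L_def power2_eq_square)
qed

text \<open>One second difference over increments scaled by \<open>s\<close> approximates both
  \<open>s\<^sup>2 * (H w \<bullet> v)\<close> and \<open>s\<^sup>2 * (H v \<bullet> w)\<close> with
  error at most \<open>2 * e * (s * L)\<^sup>2\<close>. Dividing by \<open>s\<^sup>2\<close> and
  letting \<open>e\<close> tend to 0 identifies them.\<close>

lemma second_derivative_symmetric:
  fixes f :: "'a::real_inner \<Rightarrow> real"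
  assumes "open S" "x \<in> S"
    and f: "\<And>y. y \<in> S \<Longrightarrow> (f has_derivative (\<lambda>h. G y \<bullet> h)) (at y)"
    and G: "(G has_derivative H) (at x)"
  shows "H v \<bullet> w = H w \<bullet> v"
proof -
  have H: "linear H" using G by (rule has_derivative_linear)
  define L where "L = norm v + norm w"
  have "\<bar>H w \<bullet> v - H v \<bullet> w\<bar> \<le> 4 * e * L\<^sup>2" if "0 < e" for e
  proof -
    obtain d1 where d1: "0 < d1" "ball x d1 \<subseteq> S"
      using \<open>open S\<close> \<open>x \<in> S\<close> by (meson open_contains_ball)
    obtain d2 where d2: "0 < d2"
      "\<And>y. norm (y - x) < d2 \<Longrightarrow> norm (G y - G x - H (y - x)) \<le> e * norm (y - x)"
      using G \<open>0 < e\<close> unfolding has_derivative_at_alt by blast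
    define d where "d = min d1 d2"
    have d: "0 < d" using d1 d2 by (simp add: d_def)
    have fd: "(f has_derivative (\<lambda>h. G y \<bullet> h)) (at y)" if "norm (y - x) < d" for y
      using f[of y] d1 that by (auto simp: d_def dist_norm norm_minus_commute subset_iff)
    have Gd: "norm (G y - G x - H (y - x)) \<le> e * norm (y - x)" if "norm (y - x) < d" for y
      using d2(2)[of y] that by (simp add: d_def)
    \<comment> \<open>Scales the increments into the \<open>d\<close>-ball; the added 1 covers the
      case \<open>L = 0\<close>.\<close>
    define s where "s = d / (2 * (L + 1))"
    have L: "0 \<le> L" by (simp add: L_def)
    have s: "0 < s" using d L by (simp add: s_def)
    have sL: "s * L < d"
    proof -
      have "d * L < d * (2 * (L + 1))" using d L by (intro mult_strict_left_mono) auto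
      then show ?thesis using L by (simp add: s_def field_simps)
    qed
    have eq: "norm (s *\<^sub>R v) + norm (s *\<^sub>R w) = s * L" "norm (s *\<^sub>R w) + norm (s *\<^sub>R v) = s * L"
      using s by (simp_all add: L_def algebra_simps)
    define D where "D = f (x + s *\<^sub>R v + s *\<^sub>R w) - f (x + s *\<^sub>R v) - f (x + s *\<^sub>R w) + f x"
    have "\<bar>D - s\<^sup>2 * (H w \<bullet> v)\<bar> \<le> 2 * e * (s * L)\<^sup>2"
      using second_difference_bound[of x d f G H e "s *\<^sub>R v" "s *\<^sub>R w", OF fd Gd H] sL \<open>0 < e\<close>
      by (simp add: D_def linear_scale[OF H] power2_eq_square eq mult.assoc del: norm_scaleR)
    moreover have "\<bar>D - s\<^sup>2 * (H v \<bullet> w)\<bar> \<le> 2 * e * (s * L)\<^sup>2"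
      using second_difference_bound[of x d f G H e "s *\<^sub>R w" "s *\<^sub>R v", OF fd Gd H] sL \<open>0 < e\<close>
      by (simp add: D_def linear_scale[OF H] power2_eq_square eq mult.assoc add_ac diff_diff_eq
          algebra_simps del: norm_scaleR)
    ultimately have "\<bar>s\<^sup>2 * (H w \<bullet> v) - s\<^sup>2 * (H v \<bullet> w)\<bar> \<le> s\<^sup>2 * (4 * e * L\<^sup>2)"
      unfolding power_mult_distrib by (simp only: abs_le_iff) (simp add: algebra_simps)
    then have "s\<^sup>2 * \<bar>H w \<bullet> v - H v \<bullet> w\<bar> \<le> s\<^sup>2 * (4 * e * L\<^sup>2)"
      by (simp add: abs_mult flip: right_diff_distrib)
    then show ?thesis using s by simp
  qed
  note bound = this
  have "\<bar>H w \<bullet> v - H v \<bullet> w\<bar> \<le> 0"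
  proof (rule field_le_epsilon)
    fix e :: real assume "0 < e"
    then have "4 * (e / (4 * (L\<^sup>2 + 1))) * L\<^sup>2 \<le> e"
      by (simp add: field_simps add_pos_nonneg)
    moreover have "0 < e / (4 * (L\<^sup>2 + 1))"
      using \<open>0 < e\<close> by (simp add: add_nonneg_pos)
    ultimately show "\<bar>H w \<bullet> v - H v \<bullet> w\<bar> \<le> 0 + e"
      using bound[of "e / (4 * (L\<^sup>2 + 1))"] by linarith
  qed
  then show ?thesis by simp
qed

text \<open>If the form were positive at \<open>v\<close>, the slope of \<open>f\<close> along
  \<open>v\<close>, which is zero at \<open>x\<close>, would be positive just after
  \<open>x\<close>. The mean value theorem then gives a value above the maximum.\<close>

lemma second_derivative_nonpos_at_max:
  fixes f :: "'a::real_inner \<Rightarrow> real"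
  assumes "open S" "x \<in> S"
    and f: "\<And>y. y \<in> S \<Longrightarrow> (f has_derivative (\<lambda>h. G y \<bullet> h)) (at y)"
    and G: "(G has_derivative H) (at x)"
    and max: "\<And>y. y \<in> S \<Longrightarrow> f y \<le> f x" and "G x = 0"
  shows "H v \<bullet> v \<le> 0"
proof (rule ccontr)
  assume neg: "\<not> H v \<bullet> v \<le> 0"
  have H: "linear H" using G by (rule has_derivative_linear)
  have "((\<lambda>s. G (x + s *\<^sub>R v) \<bullet> v) has_derivative (\<lambda>h. H (h *\<^sub>R v) \<bullet> v)) (at 0)"
    by (rule has_derivative_inner_left,
        rule has_derivative_compose[where g = G and f = "\<lambda>s. x + s *\<^sub>R v"])
      (use G in \<open>auto intro!: derivative_eq_intros\<close>)
  then have "((\<lambda>s. G (x + s *\<^sub>R v) \<bullet> v) has_real_derivative H v \<bullet> v) (at 0)"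
    by (simp add: has_field_derivative_def linear_scale[OF H] mult_commute_abs)
  from DERIV_pos_inc_right[OF this] obtain d where d: "0 < d"
    and inc: "\<And>s. 0 < s \<Longrightarrow> s < d \<Longrightarrow> 0 < G (x + s *\<^sub>R v) \<bullet> v"
    using neg \<open>G x = 0\<close> by auto
  have "open ((\<lambda>s. x + s *\<^sub>R v) -` S)"
    by (intro open_vimage \<open>open S\<close> continuous_intros)
  moreover have "0 \<in> (\<lambda>s. x + s *\<^sub>R v) -` S"
    using \<open>x \<in> S\<close> by simp
  ultimately obtain d1 where d1: "0 < d1" "cball 0 d1 \<subseteq> (\<lambda>s. x + s *\<^sub>R v) -` S"
    by (meson open_contains_cball)
  \<comment> \<open>\<open>d / 2\<close> keeps \<open>c\<close> strictly inside the range of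
    positive slope, \<open>d1\<close> keeps the segment in \<open>S\<close>.\<close>
  define c where "c = min (d / 2) d1"
  have c: "0 < c" "c < d" using d d1 by (auto simp: c_def)
  have inS: "x + s *\<^sub>R v \<in> S" if "0 \<le> s" "s \<le> c" for s
    using d1(2) that by (auto simp: c_def subset_iff)
  have "((\<lambda>s. f (x + s *\<^sub>R v)) has_derivative (\<lambda>h. G (x + s *\<^sub>R v) \<bullet> (h *\<^sub>R v)))
      (at s within {0..c})" if "0 \<le> s" "s \<le> c" for s
    by (rule has_derivative_compose[where g = f and f = "\<lambda>s. x + s *\<^sub>R v"])
      (use f[OF inS[OF that]] in \<open>auto intro!: derivative_eq_intros\<close>)
  from mvt_simple[OF c(1) this] obtain s where s: "s \<in> {0<..<c}"
    and "f (x + c *\<^sub>R v) - f (x + 0 *\<^sub>R v) = G (x + s *\<^sub>R v) \<bullet> ((c - 0) *\<^sub>R v)"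
    by auto
  then have "f x < f (x + c *\<^sub>R v)"
    using mult_pos_pos[OF c(1) inc[of s]] s c by simp
  with max[OF inS[of c]] c show False by simp
qed

section \<open>Monotone maps, and monotonicity of \<open>F\<close> and its inverse\<close>

text \<open>Were the form negative at \<open>h\<close>, the component of \<open>X\<close> along
  \<open>h\<close> would drop when moving from \<open>w\<close> in direction \<open>h\<close>,
  against monotonicity.\<close>

lemma monotone_map_derivative_nonneg:
  fixes X :: "'a::real_inner \<Rightarrow> 'a"
  assumes mono: "\<And>v w. 0 \<le> (X v - X w) \<bullet> (v - w)"
    and X: "(X has_derivative A) (at w)"
  shows "0 \<le> A h \<bullet> h"
proof (rule ccontr)
  assume neg: "\<not> 0 \<le> A h \<bullet> h"
  have A: "linear A" using X by (rule has_derivative_linear)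
  have "((\<lambda>s. X (w + s *\<^sub>R h) \<bullet> h) has_derivative (\<lambda>s. A (s *\<^sub>R h) \<bullet> h)) (at 0)"
    by (rule has_derivative_inner_left,
        rule has_derivative_compose[where g = X and f = "\<lambda>s. w + s *\<^sub>R h"])
      (use X in \<open>auto intro!: derivative_eq_intros\<close>)
  then have "((\<lambda>s. X (w + s *\<^sub>R h) \<bullet> h) has_real_derivative A h \<bullet> h) (at 0)"
    by (simp add: has_field_derivative_def linear_scale[OF A] mult_commute_abs)
  from DERIV_neg_dec_right[OF this] obtain d where d: "0 < d"
    and "\<And>s. 0 < s \<Longrightarrow> s < d \<Longrightarrow> X (w + s *\<^sub>R h) \<bullet> h < X w \<bullet> h"
    using neg by auto
  then have "X (w + (d / 2) *\<^sub>R h) \<bullet> h < X w \<bullet> h" by simp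
  moreover have "0 \<le> (d / 2) * ((X (w + (d / 2) *\<^sub>R h) - X w) \<bullet> h)"
    using mono[of "w + (d / 2) *\<^sub>R h" w] by simp
  ultimately show False
    using d by (simp add: inner_diff_left zero_le_mult_iff)
qed

text \<open>Cauchy-Schwarz replaces \<open>v \<bullet> w\<close> by the product of the norms, since
  its coefficient is nonpositive. What remains is that the scalar function \<open>s * g s\<close> is
  nondecreasing for \<open>s \<ge> 0\<close>.\<close>

lemma radial_map_monotone:
  fixes v w :: "'a::real_inner"
  assumes nonneg: "\<And>s. 0 \<le> s \<Longrightarrow> 0 \<le> g s"
    and mono: "\<And>r s. 0 \<le> r \<Longrightarrow> r \<le> s \<Longrightarrow> g r \<le> g s"
  shows "0 \<le> (g (norm v) *\<^sub>R v - g (norm w) *\<^sub>R w) \<bullet> (v - w)"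
proof -
  define p q where "p = g (norm v)" and "q = g (norm w)"
  have pq: "0 \<le> p" "0 \<le> q" using nonneg by (auto simp: p_def q_def)
  have "0 \<le> (p * norm v - q * norm w) * (norm v - norm w)"
  proof (cases "norm v \<le> norm w")
    case True
    then have "p * norm v \<le> q * norm w"
      using pq mono[of "norm v" "norm w"] by (intro mult_mono) (auto simp: p_def q_def)
    then show ?thesis using True by (intro mult_nonpos_nonpos) auto
  next
    case False
    then have "q * norm w \<le> p * norm v"
      using pq mono[of "norm w" "norm v"] by (intro mult_mono) (auto simp: p_def q_def)
    then show ?thesis using False by simp
  qed
  also have "\<dots> = p * (norm v)\<^sup>2 + q * (norm w)\<^sup>2 - (p + q) * (norm v * norm w)"
    by (simp add: power2_eq_square algebra_simps)
  also have "\<dots> \<le> p * (norm v)\<^sup>2 + q * (norm w)\<^sup>2 - (p + q) * (v \<bullet> w)"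
    using pq norm_cauchy_schwarz[of v w] by (intro diff_left_mono mult_left_mono) auto
  also have "\<dots> = (p *\<^sub>R v - q *\<^sub>R w) \<bullet> (v - w)"
    by (simp add: power2_norm_eq_inner inner_diff_left inner_diff_right inner_commute[of w v]
        algebra_simps)
  finally show ?thesis by (simp add: p_def q_def)
qed

lemma rpow_nonneg: "0 \<le> rpow s p"
  by (simp add: rpow_def)

lemma rpow_mono: "0 \<le> p \<Longrightarrow> 0 \<le> r \<Longrightarrow> r \<le> s \<Longrightarrow> rpow r p \<le> rpow s p"
  by (simp add: rpow_def powr_mono2)

lemma gpoly_nonneg: "(\<And>i. i \<le> N \<Longrightarrow> 0 \<le> a i) \<Longrightarrow> 0 \<le> gpoly N a \<alpha> s"
  by (auto simp: gpoly_def rpow_nonneg intro!: sum_nonneg)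

lemma gpoly_mono:
  assumes "\<And>i. i \<le> N \<Longrightarrow> 0 \<le> a i" "\<And>i. i \<le> N \<Longrightarrow> 0 \<le> \<alpha> i" "0 \<le> r" "r \<le> s"
  shows "gpoly N a \<alpha> r \<le> gpoly N a \<alpha> s"
  unfolding gpoly_def using assms by (intro sum_mono mult_left_mono rpow_mono) auto

lemma Jmat_mult: "Jmat k *v x = cross3 k x"
proof -
  have "linear (cross3 k)"
    using bilinear_cross by (simp add: bilinear_def)
  then show ?thesis by (simp add: Jmat_def)
qed

text \<open>Antisymmetry of the cross product moves one factor across. In this form both symmetry
  and negative semidefiniteness of the square are visible.\<close>

lemma Jmat_square_inner: "((Jmat k ** Jmat k) *v x) \<bullet> y = - (cross3 k x \<bullet> cross3 k y)"
proof -
  have "cross3 k (cross3 k x) \<bullet> y = - (cross3 k x \<bullet> cross3 k y)"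
    by (simp add: cross3_simps)
  then show ?thesis by (simp add: Jmat_mult flip: matrix_vector_mul_assoc)
qed

text \<open>The rotation term contributes nothing because \<open>cross3 k z\<close> is orthogonal to
  \<open>z\<close>; the remainder is a radial map with nondecreasing coefficient.\<close>

lemma Fmap_monotone:
  assumes "\<And>i. i \<le> N \<Longrightarrow> 0 \<le> a i" "\<And>i. i \<le> N \<Longrightarrow> 0 \<le> \<alpha> i"
  shows "0 \<le> (Fmap N a \<alpha> \<R> k v - Fmap N a \<alpha> \<R> k w) \<bullet> (v - w)"
proof -
  have "(Jmat k *v v - Jmat k *v w) \<bullet> (v - w) = 0"
    unfolding Jmat_mult by (simp add: cross3_simps)
  moreover have "Fmap N a \<alpha> \<R> k v - Fmap N a \<alpha> \<R> k w
      = (gpoly N a \<alpha> (norm v) *\<^sub>R v - gpoly N a \<alpha> (norm w) *\<^sub>R w)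
        + \<R> *\<^sub>R (Jmat k *v v - Jmat k *v w)"
    by (simp add: Fmap_def scaleR_right_diff_distrib)
  ultimately have "(Fmap N a \<alpha> \<R> k v - Fmap N a \<alpha> \<R> k w) \<bullet> (v - w)
      = (gpoly N a \<alpha> (norm v) *\<^sub>R v - gpoly N a \<alpha> (norm w) *\<^sub>R w) \<bullet> (v - w)"
    by (simp only: inner_add_left inner_scaleR_left)
  also have "\<dots> \<ge> 0"
    by (rule radial_map_monotone[where g = "gpoly N a \<alpha>"])
      (use assms in \<open>auto intro: gpoly_nonneg gpoly_mono\<close>)
  finally show ?thesis .
qed

text \<open>The monotonicity inequality pairs differences of arguments with differences of images,
  so it reads the same for the inverse.\<close>

lemma inv_Fmap_monotone:
  assumes "\<And>i. i \<le> N \<Longrightarrow> 0 \<le> a i" "\<And>i. i \<le> N \<Longrightarrow> 0 \<le> \<alpha> i" "bij (Fmap N a \<alpha> \<R> k)"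
  shows "0 \<le> (inv (Fmap N a \<alpha> \<R> k) v - inv (Fmap N a \<alpha> \<R> k) w) \<bullet> (v - w)"
  using assms(3) Fmap_monotone[of N a \<alpha>, OF assms(1,2),
      where k = k and \<R> = \<R> and v = "inv (Fmap N a \<alpha> \<R> k) v" and w = "inv (Fmap N a \<alpha> \<R> k) w"]
  by (simp add: bij_is_surj surj_f_inv_f inner_commute)

section \<open>The divergence term at a spatial maximum\<close>

lemma grad_has_derivative:
  fixes f :: "real^'n \<Rightarrow> real"
  assumes "f differentiable (at x)"
  shows "(f has_derivative (\<lambda>h. grad f x \<bullet> h)) (at x)"
proof -
  let ?D = "frechet_derivative f (at x)"
  have D: "(f has_derivative ?D) (at x)"
    using assms by (simp add: frechet_derivative_works)
  then have lin: "linear ?D" by (rule has_derivative_linear)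
  have "?D h = grad f x \<bullet> h" for h
  proof -
    have "?D h = ?D (\<Sum>i\<in>UNIV. h $ i *\<^sub>R axis i 1)"
      using basis_expansion[of h] by (simp add: scalar_mult_eq_scaleR)
    also have "\<dots> = grad f x \<bullet> h"
      by (simp add: linear_sum[OF lin] linear_scale[OF lin] grad_def inner_vec_def mult.commute)
    finally show ?thesis .
  qed
  then have "?D = (\<lambda>h. grad f x \<bullet> h)" by (rule ext)
  with D show ?thesis by simp
qed

lemma divergence_nonpos_at_max:
  fixes f :: "real^3 \<Rightarrow> real" and X :: "real^3 \<Rightarrow> real^3"
  assumes "open S" "x \<in> S"
    and f: "\<And>y. y \<in> S \<Longrightarrow> f differentiable (at y)"
    and G: "grad f differentiable (at x)"
    and X: "\<And>w. X differentiable (at w)"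
    and mono: "\<And>v w. 0 \<le> (X v - X w) \<bullet> (v - w)"
    and max: "\<And>y. y \<in> S \<Longrightarrow> f y \<le> f x"
  shows "divergence (\<lambda>y. X (grad f y + (f y)\<^sup>2 *\<^sub>R Zfield \<G> \<Omega> k e0 y t)) x \<le> 0"
proof -
  note df = grad_has_derivative[OF f]
  obtain H where H: "(grad f has_derivative H) (at x)"
    using G by (auto simp: differentiable_def)
  have "(\<lambda>h. grad f x \<bullet> h) = (\<lambda>h. 0)"
    by (rule differential_zero_maxmin[OF \<open>x \<in> S\<close> \<open>open S\<close> df[OF \<open>x \<in> S\<close>]]) (use max in auto)
  then have "grad f x \<bullet> grad f x = 0" by metis
  then have g0: "grad f x = 0" by simp
  let ?JJ = "\<lambda>h. (Jmat k ** Jmat k) *v h"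
  define w where "w = grad f x + (f x)\<^sup>2 *\<^sub>R Zfield \<G> \<Omega> k e0 x t"
  define B where "B h = H h + ((f x)\<^sup>2 * \<Omega>\<^sup>2) *\<^sub>R ?JJ h" for h
  obtain A where A: "(X has_derivative A) (at w)"
    using X by (auto simp: differentiable_def)
  have JJ: "(?JJ has_derivative ?JJ) (at x)"
    by (intro bounded_linear_imp_has_derivative) (rule matrix_vector_mul_bounded_linear)
  have dZ: "((\<lambda>y. Zfield \<G> \<Omega> k e0 y t) has_derivative (\<lambda>h. \<Omega>\<^sup>2 *\<^sub>R ?JJ h)) (at x)"
    unfolding Zfield_def by (rule derivative_eq_intros JJ refl)+ simp
  \<comment> \<open>Differentiating the square also produces a multiple of
    \<open>grad f x \<bullet> h\<close>, which vanishes by \<open>g0\<close>. Only the linear part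
    of the field contributes to \<open>B\<close>.\<close>
  have "((\<lambda>y. grad f y + (f y)\<^sup>2 *\<^sub>R Zfield \<G> \<Omega> k e0 y t) has_derivative B) (at x)"
    by (rule derivative_eq_intros H df[OF \<open>x \<in> S\<close>] dZ refl)+
      (simp add: g0 B_def fun_eq_iff)
  from has_derivative_compose[OF this A[unfolded w_def]]
  have "((\<lambda>y. X (grad f y + (f y)\<^sup>2 *\<^sub>R Zfield \<G> \<Omega> k e0 y t)) has_derivative (\<lambda>h. A (B h))) (at x)" .
  then have "divergence (\<lambda>y. X (grad f y + (f y)\<^sup>2 *\<^sub>R Zfield \<G> \<Omega> k e0 y t)) x
      = trace (matrix (\<lambda>h. A (B h)))"
    by (simp add: divergence_def jacobian_def frechet_derivative_at[symmetric])
  also have "\<dots> \<le> 0"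
  proof (rule trace_compose_nonpos[where A = A and B = B])
    show "linear A" using A by (rule has_derivative_linear)
    show "0 \<le> A h \<bullet> h" for h
      by (rule monotone_map_derivative_nonneg[OF mono A])
    have "linear H" using H by (rule has_derivative_linear)
    then show "linear B"
      unfolding B_def by (intro linear_compose_add linear_compose_scale_right) auto
    show "B v \<bullet> w = B w \<bullet> v" for v w
      using second_derivative_symmetric[OF \<open>open S\<close> \<open>x \<in> S\<close> df H, of v w]
      by (simp add: B_def inner_add_left Jmat_square_inner inner_commute[of "cross3 k w"])
    show "B v \<bullet> v \<le> 0" for v
      using second_derivative_nonpos_at_max[OF \<open>open S\<close> \<open>x \<in> S\<close> df H max g0, of v]
      by (simp add: B_def inner_add_left Jmat_square_inner order_trans[of _ 0])
  qed
  finally show ?thesis .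
qed

section \<open>Weak maximum principle on a space-time cylinder\<close>

text \<open>Maximise \<open>u x t - e * t\<close> over the compact cylinder. At a maximum with
  \<open>u\<close> above \<open>K\<close>, the time slice has a spatial maximum, so the left
  derivative in time is at most \<open>- e\<close> and an earlier value would be larger. Hence the
  derivative condition concerns spatial maxima only, and the derivative looks backwards, which also
  covers the final time.\<close>

lemma parabolic_weak_maximum_principle:
  fixes u :: "'a::euclidean_space \<Rightarrow> real \<Rightarrow> real"
  assumes "open U" "bounded U"
    and cont: "continuous_on (closure U \<times> {0..T}) (\<lambda>(x, t). u x t)"
    and deriv: "\<And>x t. x \<in> U \<Longrightarrow> 0 < t \<Longrightarrow> t \<le> T \<Longrightarrow> (\<And>y. y \<in> U \<Longrightarrow> u y t \<le> u x t) \<Longrightarrow>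
      \<exists>D\<le>0. (u x has_real_derivative D) (at t within {0<..t})"
    and init: "\<And>x. x \<in> closure U \<Longrightarrow> u x 0 \<le> K"
    and bdry: "\<And>x t. x \<in> frontier U \<Longrightarrow> 0 < t \<Longrightarrow> t \<le> T \<Longrightarrow> u x t \<le> K"
    and z: "z \<in> closure U" and s: "s \<in> {0..T}"
  shows "u z s \<le> K"
proof -
  have bound: "u z s \<le> K + e * T" if "0 < e" for e
  proof -
    define v where "v p = (case p of (x, t) \<Rightarrow> u x t) - e * snd p" for p
    have "compact (closure U \<times> {0..T})"
      using \<open>bounded U\<close> by (intro compact_Times) (auto simp: compact_closure)
    moreover have "continuous_on (closure U \<times> {0..T}) v"
      unfolding v_def by (intro continuous_intros cont)
    moreover have "closure U \<times> {0..T} \<noteq> {}" using z s by auto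
    ultimately obtain p where p: "p \<in> closure U \<times> {0..T}"
      "\<And>q. q \<in> closure U \<times> {0..T} \<Longrightarrow> v q \<le> v p"
      using continuous_attains_sup[of "closure U \<times> {0..T}" v] by blast
    obtain x t where xt: "p = (x, t)" by (cases p)
    have x: "x \<in> closure U" and t: "0 \<le> t" "t \<le> T" using p xt by auto
    have max: "u y r - e * r \<le> u x t - e * t" if "y \<in> closure U" "0 \<le> r" "r \<le> T" for y r
      using p(2)[of "(y, r)"] that by (simp add: xt v_def)
    have "u x t \<le> K"
    proof (rule ccontr)
      assume "\<not> u x t \<le> K"
      \<comment> \<open>The data bounds exclude the bottom and the lateral boundary, leaving an
        interior point at positive time.\<close>
      then have "t \<noteq> 0" "x \<notin> frontier U"
        using init[OF x] bdry[of x t] t by fastforce+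
      then have "0 < t" and "x \<in> U"
        using t x \<open>open U\<close> by (auto simp: frontier_def interior_open)
      have "u y t \<le> u x t" if "y \<in> U" for y
        using max[of y t] that t closure_subset[of U] by auto
      from deriv[OF \<open>x \<in> U\<close> \<open>0 < t\<close> t(2) this]
      obtain D where D: "D \<le> 0" "(u x has_real_derivative D) (at t within {0<..t})" by blast
      have "((\<lambda>r. u x r - e * r) has_real_derivative (D - e)) (at t within {0<..t})"
        by (rule derivative_eq_intros D(2) refl)+ simp
      from has_real_derivative_neg_dec_left[OF this] obtain d where d: "0 < d"
        and dec: "\<And>h. 0 < h \<Longrightarrow> t - h \<in> {0<..t} \<Longrightarrow> h < d \<Longrightarrow>
          u x t - e * t < u x (t - h) - e * (t - h)"
        using D(1) \<open>0 < e\<close> by auto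
      \<comment> \<open>Small enough for the strict decrease, and \<open>t - h\<close> stays
        positive.\<close>
      define h where "h = min (d / 2) (t / 2)"
      have "0 < h" "h < d" "h < t" using d \<open>0 < t\<close> by (auto simp: h_def)
      then show False
        using dec[of h] max[OF x, of "t - h"] t by auto
    qed
    moreover have "u z s - e * s \<le> u x t - e * t" using max[of z s] z s by auto
    moreover have "e * s \<le> e * T" "0 \<le> e * t" using \<open>0 < e\<close> s t by auto
    ultimately show ?thesis by linarith
  qed
  show ?thesis
  proof (rule field_le_epsilon)
    fix e :: real assume "0 < e"
    have "0 \<le> T" using s by auto
    \<comment> \<open>Dividing by \<open>T + 1\<close> rather than \<open>T\<close> allows
      \<open>T = 0\<close>.\<close>
    then have "e / (T + 1) * T \<le> e"
      using \<open>0 < e\<close> by (simp add: field_simps)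
    then show "u z s \<le> K + e"
      using bound[of "e / (T + 1)"] \<open>0 < e\<close> \<open>0 \<le> T\<close> by (smt (verit) divide_pos_pos)
  qed
qed

section \<open>Bounds for the data and the final estimate\<close>

text \<open>Boundedness gives the real supremum its meaning. The empty set, which occurs for the
  lateral boundary at \<open>t = 0\<close>, is covered by the default value 0.\<close>

lemma sup_abs_nonneg: "bdd_above ((\<lambda>x. \<bar>f x\<bar>) ` A) \<Longrightarrow> 0 \<le> sup_abs f A"
  unfolding sup_abs_def by (auto intro: cSUP_upper2)

lemma le_sup_abs: "bdd_above ((\<lambda>x. \<bar>f x\<bar>) ` A) \<Longrightarrow> x \<in> A \<Longrightarrow> f x \<le> sup_abs f A"
  unfolding sup_abs_def by (auto intro: cSUP_upper2)

text \<open>The maximum is expressed by a point of \<open>closure U\<close> attaining it, so its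
  existence is part of the claim.\<close>

theorem corollary3p2:
  fixes N :: nat and a \<alpha> :: "nat \<Rightarrow> real"
    and k :: "real^3" and \<R> \<phi> \<G> \<Omega> T :: real
    and U :: "(real^3) set" and e0 :: "real \<Rightarrow> real^3"
    and u :: "real^3 \<Rightarrow> real \<Rightarrow> real" and u0 :: "real^3 \<Rightarrow> real"
    and \<psi> :: "real^3 \<Rightarrow> real \<Rightarrow> real"
  defines "F \<equiv> Fmap N a \<alpha> \<R> k"
  defines "X \<equiv> inv F"
  defines "Z \<equiv> Zfield \<G> \<Omega> k e0"
  assumes "N \<ge> 1"
    and "\<alpha> 0 = 0" and "\<And>i. i < N \<Longrightarrow> \<alpha> i < \<alpha> (Suc i)"
    and "\<And>i. i \<le> N \<Longrightarrow> a i > 0"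
    and "norm k = 1" and "\<R> \<ge> 0"
    and "bij F" and "C1_on UNIV F" and "C1_on UNIV X"
    and "open U" and "bounded U" and "U \<noteq> {}" and "C1_boundary U"
    and "\<phi> > 0" and "\<G> > 0" and "\<Omega> \<ge> 0"
    and "smooth_curve e0" and "\<And>t. norm (e0 t) = 1"
    and "T > 0"
    and "continuous_on (closure U \<times> {0..T}) (\<lambda>(x, t). u x t)"
    and "C21_on U {0<..T} u"
    and "\<And>x t. x \<in> closure U \<Longrightarrow> t \<in> {0..T} \<Longrightarrow> u x t \<ge> 0"
    and "\<And>x t. x \<in> U \<Longrightarrow> t \<in> {0<..T} \<Longrightarrow>
          \<phi> * time_deriv {0<..T} u x t =
          divergence (\<lambda>y. X (grad (\<lambda>z. u z t) y + (u y t)\<^sup>2 *\<^sub>R Z y t)) x"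
    and "\<And>x. x \<in> U \<Longrightarrow> u x 0 = u0 x"
    and "\<And>x t. x \<in> frontier U \<Longrightarrow> t \<in> {0<..T} \<Longrightarrow> u x t = \<psi> x t"
  shows "\<forall>t\<in>{0..T}. \<exists>x\<in>closure U. (\<forall>y\<in>closure U. u y t \<le> u x t) \<and> u x t \<le> M0 U u0 \<psi> t"
proof
  fix t assume t: "t \<in> {0..T}"
  note cont = \<open>continuous_on (closure U \<times> {0..T}) (\<lambda>(x, t). u x t)\<close>
  have alpha_nonneg: "0 \<le> \<alpha> i" if "i \<le> N" for i
    using that
  proof (induction i)
    case (Suc i)
    then show ?case using \<open>\<And>i. i < N \<Longrightarrow> \<alpha> i < \<alpha> (Suc i)\<close>[of i] by simp
  qed (simp add: \<open>\<alpha> 0 = 0\<close>)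
  have a_nonneg: "0 \<le> a i" if "i \<le> N" for i
    using \<open>\<And>i. i \<le> N \<Longrightarrow> a i > 0\<close>[OF that] by simp
  have X_mono: "0 \<le> (X v - X w) \<bullet> (v - w)" for v w
    unfolding X_def F_def
    by (rule inv_Fmap_monotone) (use a_nonneg alpha_nonneg \<open>bij F\<close> F_def in auto)
  have X_diff: "X differentiable (at w)" for w
    using \<open>C1_on UNIV X\<close> by (auto simp: C1_on_def differentiable_def)
  have compU: "compact (closure U)" using \<open>bounded U\<close> by (simp add: compact_closure)
  have "compact ((\<lambda>(x, t). u x t) ` (closure U \<times> {0..T}))"
    by (intro compact_continuous_image cont compact_Times compU compact_Icc)
  \<comment> \<open>\<open>C\<close> also bounds \<open>u0\<close> on \<open>U\<close> and
    \<open>\<psi>\<close> on the lateral boundary, where they agree with \<open>u\<close>; this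
    makes both suprema genuine.\<close>
  then obtain C where C: "\<And>x t. x \<in> closure U \<Longrightarrow> t \<in> {0..T} \<Longrightarrow> \<bar>u x t\<bar> \<le> C"
    by (force dest!: compact_imp_bounded simp: bounded_iff)
  have UcU: "U \<subseteq> closure U" and fcU: "frontier U \<subseteq> closure U"
    by (auto simp: closure_subset frontier_def)
  let ?S = "sup_abs u0 U"
  have bddS: "bdd_above ((\<lambda>x. \<bar>u0 x\<bar>) ` U)"
    using C[of _ 0] UcU \<open>T > 0\<close> \<open>\<And>x. x \<in> U \<Longrightarrow> u x 0 = u0 x\<close> by (intro bdd_aboveI2[of _ _ C]) force
  have bddP: "bdd_above ((\<lambda>p. \<bar>case p of (x, \<tau>) \<Rightarrow> \<psi> x \<tau>\<bar>) ` (frontier U \<times> {0<..t}))"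
  proof (rule bdd_aboveI2[of _ _ C])
    fix p assume "p \<in> frontier U \<times> {0<..t}"
    then obtain x r where p: "p = (x, r)" "x \<in> frontier U" "r \<in> {0<..T}" using t by auto
    then show "\<bar>case p of (x, \<tau>) \<Rightarrow> \<psi> x \<tau>\<bar> \<le> C"
      using C[of x r] fcU \<open>\<And>x t. x \<in> frontier U \<Longrightarrow> t \<in> {0<..T} \<Longrightarrow> u x t = \<psi> x t\<close>[of x r] by auto
  qed
  have slice: "continuous_on (closure U) (\<lambda>x. u x r)" if "r \<in> {0..T}" for r
    using continuous_on_compose2[OF cont, of "closure U" "\<lambda>x. (x, r)"] that
    by (simp add: continuous_on_Pair image_subset_iff)
  have "u y t \<le> M0 U u0 \<psi> t" if "y \<in> closure U" for y
  \<comment> \<open>The cylinder ends at \<open>t\<close> rather than \<open>T\<close>, because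
    \<open>M0 U u0 \<psi> t\<close> sees the boundary data only up to time \<open>t\<close>.\<close>
  proof (rule parabolic_weak_maximum_principle[where u = u and T = t and s = t,
        OF \<open>open U\<close> \<open>bounded U\<close> _ _ _ _ that])
    show "continuous_on (closure U \<times> {0..t}) (\<lambda>(x, t). u x t)"
      by (rule continuous_on_subset[OF cont]) (use t in auto)
    show "t \<in> {0..t}" using t by simp
    show "u x 0 \<le> M0 U u0 \<psi> t" if "x \<in> closure U" for x
    proof -
      \<comment> \<open>The initial condition is given on \<open>U\<close> only; continuity of the
        slice at time 0 carries the bound to the closure.\<close>
      have "u x 0 \<le> ?S"
      proof (rule continuous_le_on_closure[OF slice that])
        show "u y 0 \<le> ?S" if "y \<in> U" for y
          using le_sup_abs[OF bddS that] \<open>\<And>x. x \<in> U \<Longrightarrow> u x 0 = u0 x\<close>[OF that] by simp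
      qed (use \<open>T > 0\<close> in simp)
      then show ?thesis using sup_abs_nonneg[OF bddP] by (simp add: M0_def)
    qed
    show "u x r \<le> M0 U u0 \<psi> t" if "x \<in> frontier U" "0 < r" "r \<le> t" for x r
      using le_sup_abs[OF bddP, of "(x, r)"] that t sup_abs_nonneg[OF bddS]
        \<open>\<And>x t. x \<in> frontier U \<Longrightarrow> t \<in> {0<..T} \<Longrightarrow> u x t = \<psi> x t\<close>[of x r]
      by (simp add: M0_def)
    fix x r assume x: "x \<in> U" and r: "0 < r" "r \<le> t" and max: "\<And>y. y \<in> U \<Longrightarrow> u y r \<le> u x r"
    have rT: "r \<in> {0<..T}" using r t by auto
    note C21 = \<open>C21_on U {0<..T} u\<close>[unfolded C21_on_def]
    have "divergence (\<lambda>y. X (grad (\<lambda>z. u z r) y + (u y r)\<^sup>2 *\<^sub>R Z y r)) x \<le> 0"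
      unfolding Z_def
      by (rule divergence_nonpos_at_max[where f = "\<lambda>z. u z r", OF \<open>open U\<close> x _ _ X_diff X_mono max])
        (use C21 x rT in auto)
    then have "\<phi> * time_deriv {0<..T} u x r \<le> 0"
      using x rT \<open>\<And>x t. x \<in> U \<Longrightarrow> t \<in> {0<..T} \<Longrightarrow>
          \<phi> * time_deriv {0<..T} u x t =
          divergence (\<lambda>y. X (grad (\<lambda>z. u z t) y + (u y t)\<^sup>2 *\<^sub>R Z y t)) x\<close> by simp
    then have "time_deriv {0<..T} u x r \<le> 0"
      using \<open>\<phi> > 0\<close> by (simp add: mult_le_0_iff)
    moreover have "(u x has_vector_derivative time_deriv {0<..T} u x r) (at r within {0<..T})"
      unfolding time_deriv_def using C21 x rT by (auto simp: vector_derivative_works)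
    \<comment> \<open>Restricting to times up to \<open>r\<close> gives the backward derivative that
      the maximum principle asks for.\<close>
    then have "(u x has_real_derivative time_deriv {0<..T} u x r) (at r within {0<..r})"
      unfolding has_real_derivative_iff_has_vector_derivative
      by (rule has_vector_derivative_within_subset) (use rT in auto)
    ultimately show "\<exists>D\<le>0. (u x has_real_derivative D) (at r within {0<..r})" by blast
  qed
  moreover obtain x where "x \<in> closure U" "\<forall>y\<in>closure U. u y t \<le> u x t"
    using continuous_attains_sup[OF compU _ slice[OF t]] \<open>U \<noteq> {}\<close> by auto
  ultimately show "\<exists>x\<in>closure U. (\<forall>y\<in>closure U. u y t \<le> u x t) \<and> u x t \<le> M0 U u0 \<psi> t"
    by blast
qed

end
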